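(* For every simple lattice polytope $\Delta$ of dimension $n$ and every $p=0,1,\dots,n$, $$\sum_{j=0}^p(-1)^j\binom{n-j}{p-j}\sum_{F\in\mathcal F_{n-j}(\Delta)}l(F)=\sum_{s=p}^n\binom{s}{p}\sum_{\Gamma\in\mathcal F_s(\Delta)}l^*(\Gamma).$$
   Context: A lattice polytope is the convex hull of finitely many points of a lattice $M\cong\mathbb Z^n$ in $M_{\mathbb R}$; it is simple if exactly $n$ edges meet at each vertex. $\mathcal F_k(\Delta)$ is the set of $k$-dimensional faces of $\Delta$, $l(F)$ the number of lattice points in $F$, and $l^*(\Gamma)$ the number of lattice points in the relative interior of $\Gamma$ (for a vertex, $l^*=1$). *)

theory Defs
  imports "HOL-Analysis.Analysis"
begin

definition lattice_points :: "(real^'n) set" where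
  "lattice_points = {x. \<forall>i. x $ i \<in> \<int>}"

definition lattice_polytope :: "(real^'n) set \<Rightarrow> bool" where
  "lattice_polytope P \<longleftrightarrow> (\<exists>S. finite S \<and> S \<subseteq> lattice_points \<and> P = convex hull S)"

definition faces_of_dim :: "nat \<Rightarrow> (real^'n) set \<Rightarrow> (real^'n) set set" where
  "faces_of_dim k P = {F. F face_of P \<and> aff_dim F = int k}"

definition simple_polytope :: "(real^'n) set \<Rightarrow> bool" where
  "simple_polytope P \<longleftrightarrow>
     (\<forall>v. v extreme_point_of P \<longrightarrow>
        card {E \<in> faces_of_dim 1 P. v \<in> E} = nat (aff_dim P))"

definition lcount :: "(real^'n) set \<Rightarrow> nat" where
  "lcount F = card (F \<inter> lattice_points)"

definition lcount_int :: "(real^'n) set \<Rightarrow> nat" where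
  "lcount_int F = card (rel_interior F \<inter> lattice_points)"

end

theory Submission
  imports Defs
begin

text \<open>
  A polytope is the disjoint union of the relative interiors of its faces, so \<open>l(F)\<close> is the sum of
  \<open>l\<^sup>*(\<Gamma>)\<close> over the faces \<open>\<Gamma>\<close> of \<open>F\<close>. Cutting a simple \<open>n\<close>-polytope near a vertex \<open>v\<close> by a halfspace
  that contains no other vertex leaves the convex hull of \<open>v\<close> and one point on each edge at \<open>v\<close>; these
  are \<open>n + 1\<close> points spanning dimension \<open>n\<close>, hence a simplex. Faces of the polytope at \<open>v\<close> therefore
  correspond to sets of vertices of the simplex containing \<open>v\<close>, and an \<open>s\<close>-face lies in exactly
  \<open>(n - s) choose j\<close> faces of dimension \<open>n - j\<close>. Exchanging sums reduces the theorem to an alternating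
  binomial identity.
\<close>

section \<open>Lattice point counts as sums over faces\<close>

text \<open>The coordinates of lattice points in a bounded set range over finitely many integers.
  Finiteness is what makes the \<open>card\<close>-based counts additive over disjoint
  unions.\<close>

lemma finite_bounded_Int_lattice_points:
  fixes S :: "(real^'n) set"
  assumes "bounded S"
  shows "finite (S \<inter> lattice_points)"
proof -
  obtain B where B: "\<And>x. x \<in> S \<Longrightarrow> norm x \<le> B"
    using assms bounded_iff by blast
  have "finite (UNIV \<rightarrow>\<^sub>E {k :: real. k \<in> \<int> \<and> \<bar>k\<bar> \<le> B} :: ('n \<Rightarrow> real) set)"
    by (intro finite_PiE finite_abs_int_segment) simp
  then have "finite (($) -` (UNIV \<rightarrow>\<^sub>E {k :: real. k \<in> \<int> \<and> \<bar>k\<bar> \<le> B}) :: (real^'n) set)"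
    by (rule finite_vimageI) (simp add: inj_def vec_nth_inject)
  moreover have "S \<inter> lattice_points \<subseteq> ($) -` (UNIV \<rightarrow>\<^sub>E {k :: real. k \<in> \<int> \<and> \<bar>k\<bar> \<le> B})"
    using B by (auto simp: lattice_points_def intro: order_trans [OF component_le_norm_cart])
  ultimately show ?thesis
    by (rule rev_finite_subset)
qed

text \<open>A face of least dimension containing \<open>x\<close> works: outside its relative
  interior \<open>x\<close> would lie in one of its facets, a face of smaller dimension.\<close>

lemma polyhedron_point_in_rel_interior_face:
  fixes P :: "'a::euclidean_space set"
  assumes "polyhedron P" "x \<in> P"
  obtains F where "F face_of P" "x \<in> rel_interior F"
proof -
  let ?Q = "\<lambda>F. F face_of P \<and> x \<in> F"
  have "?Q P"
    using assms by (simp add: face_of_refl polyhedron_imp_convex)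
  \<comment> \<open>Affine dimension starts at -1, so the shift by 1 makes \<open>nat\<close> a
    faithful measure.\<close>
  then obtain F where F: "?Q F"
    and min: "\<And>G. ?Q G \<Longrightarrow> nat (aff_dim F + 1) \<le> nat (aff_dim G + 1)"
    using ex_has_least_nat [of ?Q P "\<lambda>F. nat (aff_dim F + 1)"] by blast
  have "x \<in> rel_interior F"
  proof (rule ccontr)
    assume "x \<notin> rel_interior F"
    moreover have "polyhedron F"
      using F assms face_of_polyhedron_polyhedron by blast
    ultimately obtain G where G: "G facet_of F" "x \<in> G"
      using F rel_boundary_of_polyhedron [of F] by auto
    then have "?Q G" "aff_dim G = aff_dim F - 1"
      using F facet_of_def face_of_trans by blast+
    then show False
      using min [of G] aff_dim_geq [of G] by linarith
  qed
  with F that show ?thesis by blast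
qed

text \<open>Each point of \<open>P\<close> lies in the relative interior of exactly one face:
  existence is the preceding lemma, uniqueness is \<open>face_of_eq\<close>. The sum includes
  \<open>P\<close> itself and the empty face, which contributes 0.\<close>

lemma lcount_eq_sum_lcount_int:
  fixes P :: "(real^'n) set"
  assumes "polytope P"
  shows "lcount P = (\<Sum>F | F face_of P. lcount_int F)"
proof -
  have "P \<inter> lattice_points = (\<Union>F\<in>{F. F face_of P}. rel_interior F \<inter> lattice_points)"
  proof safe
    fix x assume "x \<in> P" "x \<in> lattice_points"
    then show "x \<in> (\<Union>F\<in>{F. F face_of P}. rel_interior F \<inter> lattice_points)"
      using polyhedron_point_in_rel_interior_face [OF polytope_imp_polyhedron [OF assms]] by blast
  next
    fix x F assume "x \<in> rel_interior F" "F face_of P"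
    then show "x \<in> P"
      using face_of_imp_subset rel_interior_subset by blast
  qed
  moreover have "card (\<Union>F\<in>{F. F face_of P}. rel_interior F \<inter> lattice_points)
      = (\<Sum>F | F face_of P. card (rel_interior F \<inter> lattice_points))"
  proof (rule card_UN_disjoint)
    show "finite {F. F face_of P}"
      by (rule finite_polytope_faces [OF assms])
    show "\<forall>F\<in>{F. F face_of P}. finite (rel_interior F \<inter> lattice_points)"
    proof
      fix F assume "F \<in> {F. F face_of P}"
      then have "rel_interior F \<subseteq> P"
        using face_of_imp_subset rel_interior_subset by blast
      then show "finite (rel_interior F \<inter> lattice_points)"
        using assms bounded_subset finite_bounded_Int_lattice_points polytope_imp_bounded by blast
    qed
    show "\<forall>F\<in>{F. F face_of P}. \<forall>G\<in>{F. F face_of P}. F \<noteq> G \<longrightarrow>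
      rel_interior F \<inter> lattice_points \<inter> (rel_interior G \<inter> lattice_points) = {}"
      using face_of_eq [of _ P] by blast
  qed
  ultimately show ?thesis
    by (simp add: lcount_def lcount_int_def)
qed

section \<open>Cutting a polytope near a vertex\<close>

text \<open>Since \<open>P - {v}\<close> is convex, it contains the hull of the other vertices. That
  hull is closed and misses \<open>v\<close>, so a hyperplane separates them strictly.\<close>

lemma polytope_extreme_point_separated:
  fixes P :: "'a::euclidean_space set"
  assumes "polytope P" "v extreme_point_of P"
  obtains a b where "a \<bullet> v < b" "\<And>w. w extreme_point_of P \<Longrightarrow> w \<noteq> v \<Longrightarrow> a \<bullet> w > b"
proof -
  let ?W = "{w. w extreme_point_of P} - {v}"
  have fin: "finite {w. w extreme_point_of P}"
    using assms finite_polyhedron_extreme_points polytope_imp_polyhedron by blast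
  have "v \<notin> convex hull ?W"
  proof
    assume v: "v \<in> convex hull ?W"
    have "?W \<subseteq> P - {v}"
      by (auto simp: extreme_point_of_def)
    moreover have "convex (P - {v})"
      using assms extreme_point_of_stillconvex polytope_imp_convex by blast
    ultimately show False
      using v hull_minimal [of ?W "P - {v}" convex] by blast
  qed
  moreover have "closed (convex hull ?W)"
    using fin by (simp add: compact_imp_closed finite_imp_compact_convex_hull)
  ultimately obtain a b where ab: "a \<bullet> v < b" "\<forall>x\<in>convex hull ?W. a \<bullet> x > b"
    using separating_hyperplane_closed_point [of "convex hull ?W" v] by auto
  show ?thesis
  proof (rule that [OF ab(1)])
    fix w assume "w extreme_point_of P" "w \<noteq> v"
    then have "w \<in> convex hull ?W"
      by (intro hull_inc) auto
    with ab show "a \<bullet> w > b" by blast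
  qed
qed

text \<open>If \<open>y\<close> differed from \<open>x\<close>, a short segment centred at
  \<open>x\<close> in the direction of \<open>y\<close> would stay in \<open>F\<close>, as
  \<open>x\<close> is relatively interior, and in the halfspace, either because \<open>x\<close> has
  slack or because the direction is parallel to the hyperplane. But an extreme point is no
  midpoint.\<close>

lemma extreme_point_of_cut_face:
  fixes F :: "'a::euclidean_space set"
  assumes x: "x extreme_point_of P \<inter> {x. a \<bullet> x \<le> b}"
    and F: "F \<subseteq> P" "x \<in> rel_interior F"
    and y: "y \<in> affine hull F"
    and xy: "a \<bullet> x < b \<or> a \<bullet> y = b"
  shows "y = x"
proof (rule ccontr)
  assume "y \<noteq> x"
  have xb: "a \<bullet> x \<le> b"
    using x by (auto simp: extreme_point_of_def)
  have xF: "x \<in> affine hull F"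
    using F(2) rel_interior_subset [of F] by (auto intro: hull_inc)
  obtain e where e: "e > 0" "ball x e \<inter> affine hull F \<subseteq> F"
    using F mem_rel_interior_ball by blast
  define d where "d = y - x"
  have "\<exists>t>0. t * norm d < e \<and> (a \<bullet> x < b \<longrightarrow> t * \<bar>a \<bullet> d\<bar> < b - a \<bullet> x)"
  proof -
    have "((\<lambda>t. t * norm d) \<longlongrightarrow> 0 * norm d) (at_right 0)"
      and "((\<lambda>t. t * \<bar>a \<bullet> d\<bar>) \<longlongrightarrow> 0 * \<bar>a \<bullet> d\<bar>) (at_right 0)"
      by (intro tendsto_intros)+
    then have "\<forall>\<^sub>F t in at_right 0. t * norm d < e"
      and "\<forall>\<^sub>F t in at_right 0. a \<bullet> x < b \<longrightarrow> t * \<bar>a \<bullet> d\<bar> < b - a \<bullet> x"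
      using e by (auto simp: order_tendsto_iff)
    moreover have "\<forall>\<^sub>F t :: real in at_right 0. t > 0"
      by (rule eventually_at_right_less)
    ultimately have "\<forall>\<^sub>F t in at_right 0. t > 0 \<and> t * norm d < e \<and>
        (a \<bullet> x < b \<longrightarrow> t * \<bar>a \<bullet> d\<bar> < b - a \<bullet> x)"
      by eventually_elim auto
    then show ?thesis
      using eventually_happens' [OF trivial_limit_at_right_real] by blast
  qed
  then obtain t where t: "t > 0" "t * norm d < e" "a \<bullet> x < b \<Longrightarrow> t * \<bar>a \<bullet> d\<bar> < b - a \<bullet> x"
    by blast
  have mem: "x + s *\<^sub>R d \<in> P \<inter> {x. a \<bullet> x \<le> b}" if s: "\<bar>s\<bar> = t" for s
  proof -
    have "x + s *\<^sub>R d = (1 - s) *\<^sub>R x + s *\<^sub>R y"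
      by (simp add: d_def algebra_simps)
    then have "x + s *\<^sub>R d \<in> affine hull F"
      using mem_affine [OF affine_affine_hull xF y, of "1 - s" s] by simp
    moreover have "x + s *\<^sub>R d \<in> ball x e"
      using s t by (simp add: dist_norm)
    moreover have "a \<bullet> (x + s *\<^sub>R d) \<le> b"
    proof (cases "a \<bullet> x < b")
      case True
      have "s * (a \<bullet> d) \<le> t * \<bar>a \<bullet> d\<bar>"
        using s abs_ge_self [of "s * (a \<bullet> d)"] by (simp add: abs_mult)
      with t True show ?thesis
        by (simp add: inner_add_right)
    next
      case False
      then have "a \<bullet> d = 0"
        using xy xb by (simp add: d_def inner_diff_right)
      with xb show ?thesis
        by (simp add: inner_add_right)
    qed
    ultimately show ?thesis
      using e F by auto
  qed
  have "x \<in> open_segment (x + t *\<^sub>R d) (x + (- t) *\<^sub>R d)"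
  proof -
    have "x + t *\<^sub>R d \<noteq> x + (- t) *\<^sub>R d"
    proof
      assume "x + t *\<^sub>R d = x + (- t) *\<^sub>R d"
      then have "(2 * t) *\<^sub>R d = 0"
        by (simp add: algebra_simps flip: scaleR_2)
      with t \<open>y \<noteq> x\<close> show False by (simp add: d_def)
    qed
    moreover have "x = midpoint (x + t *\<^sub>R d) (x + (- t) *\<^sub>R d)"
      by (simp add: midpoint_def flip: scaleR_2)
    ultimately show ?thesis
      by (metis midpoint_in_open_segment)
  qed
  with x mem [of t] mem [of "- t"] t show False
    by (auto simp: extreme_point_of_def)
qed

text \<open>The new vertices of the cut polytope are the points where edges at \<open>v\<close>
  cross the cutting hyperplane. The edge is the face with \<open>x\<close> in its relative
  interior.\<close>

lemma extreme_point_of_cut_edge: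
  fixes P :: "'a::euclidean_space set"
  assumes P: "polytope P" and v: "a \<bullet> v < b"
    and sep: "\<And>w. w extreme_point_of P \<Longrightarrow> w \<noteq> v \<Longrightarrow> a \<bullet> w > b"
    and x: "x extreme_point_of P \<inter> {x. a \<bullet> x \<le> b}" "x \<noteq> v"
  obtains E where "E face_of P" "aff_dim E = 1" "v \<in> E" "E \<inter> {x. a \<bullet> x = b} = {x}"
proof -
  have xP: "x \<in> P" "a \<bullet> x \<le> b"
    using x by (auto simp: extreme_point_of_def)
  obtain E where E: "E face_of P" "x \<in> rel_interior E"
    using polyhedron_point_in_rel_interior_face P polytope_imp_polyhedron xP by metis
  have EP: "E \<subseteq> P" and xE: "x \<in> E"
    using E face_of_imp_subset rel_interior_subset by blast+
  note uniq = extreme_point_of_cut_face [OF x(1) EP E(2)]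
  \<comment> \<open>Otherwise \<open>x\<close> would be a vertex of \<open>P\<close> other than
    \<open>v\<close>, hence strictly beyond the hyperplane.\<close>
  have single: False if "affine hull E = {x}"
  proof -
    have "E = {x}"
      using that xE hull_subset [of E affine] by auto
    then have "x extreme_point_of P"
      using E by (simp add: face_of_singleton)
    then show False
      using sep x xP by fastforce
  qed
  have xb: "a \<bullet> x = b"
  proof (rule ccontr)
    assume "a \<bullet> x \<noteq> b"
    then have "affine hull E = {x}"
      using uniq xP xE by (auto intro: hull_inc)
    with single show False .
  qed
  have inter: "affine hull E \<inter> {x. a \<bullet> x = b} = {x}"
    using uniq xb xE hull_inc [of x E affine] by blast
  \<comment> \<open>A hyperplane meets an affine set in nothing, in the whole set, or in one
    dimension less. The point \<open>x\<close> excludes the first case and \<open>single\<close> the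
    second, so a one-point section forces dimension 1.\<close>
  have "aff_dim (affine hull E) = 1"
    using aff_dim_affine_Int_hyperplane [OF affine_affine_hull [of E], of a b] inter single
    by (auto split: if_splits)
  then have dim: "aff_dim E = 1" by simp
  \<comment> \<open>Without \<open>v\<close>, all vertices of \<open>E\<close> would lie strictly
    beyond the hyperplane, and so would \<open>x\<close>.\<close>
  have "v \<in> E"
  proof (rule ccontr)
    assume "v \<notin> E"
    have "{w. w extreme_point_of E} \<subseteq> {y. a \<bullet> y > b}"
      using sep E \<open>v \<notin> E\<close> by (auto simp: extreme_point_of_face)
    then have "convex hull {w. w extreme_point_of E} \<subseteq> {y. a \<bullet> y > b}"
      by (intro hull_minimal convex_halfspace_gt)
    moreover have "E = convex hull {w. w extreme_point_of E}"
      using E P by (intro Krein_Milman_Minkowski)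
        (auto simp: face_of_polytope_polytope polytope_imp_compact polytope_imp_convex)
    ultimately show False
      using xE xb by auto
  qed
  moreover have "E \<inter> {x. a \<bullet> x = b} = {x}"
    using inter xE xb hull_subset [of E affine] by blast
  ultimately show ?thesis
    using that E dim by blast
qed

text \<open>The open halfspace already meets \<open>F\<close>, at \<open>v\<close>, and intersecting
  a convex set with an open set that meets it keeps the affine hull.\<close>

lemma affine_hull_convex_Int_halfspace_le:
  fixes F :: "'a::euclidean_space set"
  assumes "convex F" "v \<in> F" "a \<bullet> v < b"
  shows "affine hull (F \<inter> {x. a \<bullet> x \<le> b}) = affine hull F"
proof
  have "affine hull F = affine hull (F \<inter> {x. a \<bullet> x < b})"
    using assms by (subst affine_hull_convex_Int_open) (auto simp: open_halfspace_lt)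
  also have "\<dots> \<subseteq> affine hull (F \<inter> {x. a \<bullet> x \<le> b})"
    by (rule hull_mono) auto
  finally show "affine hull F \<subseteq> affine hull (F \<inter> {x. a \<bullet> x \<le> b})" .
qed (simp add: hull_mono)

text \<open>Sending each vertex of the cut other than \<open>v\<close> to its edge at
  \<open>v\<close> is injective, so there are at most \<open>aff_dim P + 1\<close> vertices. Since
  they span dimension \<open>aff_dim P\<close>, they are affinely independent.\<close>

lemma simple_vertex_cut_simplex:
  fixes P :: "'a::euclidean_space set"
  assumes P: "polytope P" and v: "v extreme_point_of P" "a \<bullet> v < b"
    and sep: "\<And>w. w extreme_point_of P \<Longrightarrow> w \<noteq> v \<Longrightarrow> a \<bullet> w > b"
    and edges: "int (card {E. E face_of P \<and> aff_dim E = 1 \<and> v \<in> E}) \<le> aff_dim P"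
  obtains V where "\<not> affine_dependent V" "v \<in> V" "P \<inter> {x. a \<bullet> x \<le> b} = convex hull V"
    "aff_dim V = aff_dim P"
proof -
  let ?P' = "P \<inter> {x. a \<bullet> x \<le> b}"
  define V where "V = {x. x extreme_point_of ?P'}"
  let ?E = "{E. E face_of P \<and> aff_dim E = 1 \<and> v \<in> E}"
  have P': "polytope ?P'"
    using P by (simp add: polytope_Int_polyhedron polyhedron_halfspace_le)
  have hull: "?P' = convex hull V"
    unfolding V_def using P' Krein_Milman_Minkowski polytope_imp_compact polytope_imp_convex by blast
  have fin: "finite V"
    unfolding V_def using P' finite_polyhedron_extreme_points polytope_imp_polyhedron by blast
  have vV: "v \<in> V"
    using v by (auto simp: V_def extreme_point_of_def)
  have "affine hull ?P' = affine hull P"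
    using P v by (intro affine_hull_convex_Int_halfspace_le)
      (auto simp: extreme_point_of_def polytope_imp_convex)
  then have dim: "aff_dim V = aff_dim P"
    by (metis aff_dim_affine_hull aff_dim_convex_hull hull)
  have "\<forall>x\<in>V - {v}. \<exists>E. E \<in> ?E \<and> E \<inter> {x. a \<bullet> x = b} = {x}"
  proof
    fix x assume "x \<in> V - {v}"
    then have x: "x extreme_point_of ?P'" "x \<noteq> v"
      by (auto simp: V_def)
    show "\<exists>E. E \<in> ?E \<and> E \<inter> {x. a \<bullet> x = b} = {x}"
      by (rule extreme_point_of_cut_edge [OF P v(2) sep x]) blast+
  qed
  then obtain f where f: "\<And>x. x \<in> V - {v} \<Longrightarrow> f x \<in> ?E"
    "\<And>x. x \<in> V - {v} \<Longrightarrow> f x \<inter> {x. a \<bullet> x = b} = {x}"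
    unfolding bchoice_iff by blast
  \<comment> \<open>An edge determines its vertex as its only point on the hyperplane.\<close>
  have "inj_on f (V - {v})"
    by (rule inj_onI) (metis f(2) singleton_inject)
  moreover have "finite ?E"
    using finite_polytope_faces [OF P] by (rule rev_finite_subset) auto
  ultimately have "card (V - {v}) \<le> card ?E"
    using f(1) by (intro card_inj_on_le [of f]) auto
  then have "int (card V) - 1 \<le> aff_dim P"
    using edges vV fin by (simp add: card_Diff_singleton)
  then have "\<not> affine_dependent V"
    using aff_dim_le_card [OF fin] dim fin by (simp add: affine_independent_iff_card)
  with that vV hull dim show ?thesis by blast
qed

text \<open>Shrinking a segment of \<open>P\<close> towards \<open>v\<close> moves it into the cut polytope without changing whether
  its points lie in the affine hull of \<open>G\<close>.\<close>
lemma face_of_cut_extends: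
  fixes P :: "'a::euclidean_space set"
  assumes P: "convex P" and G: "G face_of P \<inter> {x. a \<bullet> x \<le> b}"
    and v: "v \<in> G" "a \<bullet> v < b"
  shows "P \<inter> affine hull G face_of P"
  unfolding face_of_def
proof (intro conjI ballI impI)
  let ?P' = "P \<inter> {x. a \<bullet> x \<le> b}"
  have P': "convex ?P'"
    using P by (simp add: convex_Int convex_halfspace_le)
  have GP: "G = affine hull G \<inter> ?P'"
    by (rule face_of_imp_eq_affine_Int [OF P' G])
  then have vP: "v \<in> P" using v by blast
  show "convex (P \<inter> affine hull G)"
    using P by (simp add: convex_Int affine_imp_convex)
  fix p q x
  assume p: "p \<in> P" and q: "q \<in> P" and x: "x \<in> P \<inter> affine hull G" "x \<in> open_segment p q"
  define h where "h t y = v + t *\<^sub>R (y - v)" for t :: real and y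
  have h: "h t y = (1 - t) *\<^sub>R v + t *\<^sub>R y" for t y
    by (simp add: h_def algebra_simps)
  have ev: "\<forall>\<^sub>F t in at_right 0. a \<bullet> h t y < b" for y
  proof -
    have "((\<lambda>t. a \<bullet> h t y) \<longlongrightarrow> a \<bullet> (v + 0 *\<^sub>R (y - v))) (at_right 0)"
      unfolding h_def by (intro tendsto_intros)
    then show ?thesis
      using v by (auto simp: order_tendsto_iff)
  qed
  have "\<forall>\<^sub>F t :: real in at_right 0. t \<in> {0<..<1}"
    by (rule eventually_at_right_real) simp
  then have "\<forall>\<^sub>F t in at_right 0. t \<in> {0<..<1} \<and> a \<bullet> h t p < b \<and> a \<bullet> h t q < b \<and> a \<bullet> h t x < b"
    using ev [of p] ev [of q] ev [of x] by eventually_elim auto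
  then obtain t where t: "0 < t" "t < 1" "a \<bullet> h t p < b" "a \<bullet> h t q < b" "a \<bullet> h t x < b"
    by (auto dest!: eventually_happens' [OF trivial_limit_at_right_real])
  have hP: "h t y \<in> P" if "y \<in> P" for y
    unfolding h using P vP that t by (auto simp: convex_alt)
  have "h t x \<in> affine hull G"
    unfolding h using x v by (intro mem_affine [OF affine_affine_hull]) (auto simp: hull_inc)
  then have hx: "h t x \<in> G"
    using GP hP x t by auto
  have seg: "h t x \<in> open_segment (h t p) (h t q)"
  proof -
    obtain u where u: "p \<noteq> q" "0 < u" "u < 1" "x = (1 - u) *\<^sub>R p + u *\<^sub>R q"
      using x by (auto simp: in_segment)
    have "h t x = (1 - u) *\<^sub>R h t p + u *\<^sub>R h t q"
      by (simp add: u h_def algebra_simps)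
    moreover have "h t p \<noteq> h t q"
      using u t by (simp add: h_def)
    ultimately show ?thesis
      using u by (auto simp: in_segment)
  qed
  have mem: "h t p \<in> G \<and> h t q \<in> G"
    by (rule face_ofD [OF G seg]) (use hP p q t hx in auto)
  \<comment> \<open>The inverse homothety, with centre \<open>v\<close> and ratio
    \<open>1 / t\<close>, may leave \<open>G\<close> but preserves its affine hull.\<close>
  have unshrink: "y \<in> affine hull G" if "h t y \<in> G" for y
  proof -
    have "y = (1 - 1 / t) *\<^sub>R v + (1 / t) *\<^sub>R h t y"
      using t by (simp add: h_def algebra_simps)
    moreover have "(1 - 1 / t) *\<^sub>R v + (1 / t) *\<^sub>R h t y \<in> affine hull G"
      using that v by (intro mem_affine [OF affine_affine_hull]) (auto simp: hull_inc)
    ultimately show ?thesis by metis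
  qed
  show "p \<in> P \<inter> affine hull G" "q \<in> P \<inter> affine hull G"
    using p q mem unshrink by auto
qed auto

section \<open>Counting faces at a vertex of a simple polytope\<close>

text \<open>The faces at \<open>v\<close> of the simplex \<open>convex hull V\<close> are given by
  the subsets of \<open>V\<close> containing \<open>v\<close>. Writing faces of \<open>P\<close> as
  sections by affine hulls transfers this to \<open>P\<close> and removes the cutting hyperplane
  from the statement.\<close>

lemma simple_vertex_faces:
  fixes P :: "'a::euclidean_space set"
  assumes P: "polytope P" and v: "v extreme_point_of P"
    and edges: "int (card {E. E face_of P \<and> aff_dim E = 1 \<and> v \<in> E}) \<le> aff_dim P"
  obtains V where "\<not> affine_dependent V" "v \<in> V" "V \<subseteq> P" "aff_dim V = aff_dim P"
    "\<And>c. v \<in> c \<Longrightarrow> c \<subseteq> V \<Longrightarrow> P \<inter> affine hull c face_of P"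
    "\<And>F. F face_of P \<Longrightarrow> v \<in> F \<Longrightarrow> \<exists>c. v \<in> c \<and> c \<subseteq> V \<and> F = P \<inter> affine hull c"
proof -
  obtain a b where ab: "a \<bullet> v < b" "\<And>w. w extreme_point_of P \<Longrightarrow> w \<noteq> v \<Longrightarrow> a \<bullet> w > b"
    using polytope_extreme_point_separated [OF P v] by blast
  let ?H = "{x. a \<bullet> x \<le> b}"
  obtain V where V: "\<not> affine_dependent V" "v \<in> V" "P \<inter> ?H = convex hull V"
    "aff_dim V = aff_dim P"
    using simple_vertex_cut_simplex [OF P v ab edges] by blast
  have conv: "convex P"
    using P polytope_imp_convex by blast
  show ?thesis
  proof (rule that [OF V(1,2) _ V(4)])
    show "V \<subseteq> P"
      using V(3) hull_subset [of V convex] by blast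
  next
    fix c assume c: "v \<in> c" "c \<subseteq> V"
    have "convex hull c face_of P \<inter> ?H"
      unfolding V(3) using c V(1) face_of_convex_hull_affine_independent by blast
    then have "P \<inter> affine hull (convex hull c) face_of P"
      using c ab by (intro face_of_cut_extends [OF conv, where v = v]) (auto simp: hull_inc)
    then show "P \<inter> affine hull c face_of P"
      by simp
  next
    fix F assume F: "F face_of P" "v \<in> F"
    have "F \<inter> ?H face_of P \<inter> ?H"
      using F by (intro face_of_slice convex_halfspace_le)
    then obtain c where c: "c \<subseteq> V" "F \<inter> ?H = convex hull c"
      unfolding V(3) using V(1) face_of_convex_hull_affine_independent by blast
    \<comment> \<open>The point \<open>v\<close> remains a vertex after the cut, and every vertex of
      \<open>convex hull c\<close> belongs to \<open>c\<close>.\<close>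
    have "v extreme_point_of F"
      using F v extreme_point_of_face by blast
    then have "v extreme_point_of F \<inter> ?H"
      using ab by (auto simp: extreme_point_of_def)
    then have "v \<in> c"
      unfolding c(2) by (rule extreme_point_of_convex_hull)
    \<comment> \<open>The cut keeps the affine hull, and a face is recovered from its affine
      hull.\<close>
    have "affine hull F = affine hull c"
      using affine_hull_convex_Int_halfspace_le [OF _ F(2) ab(1)] F(1) c(2)
      by (simp add: face_of_imp_convex)
    then have "F = P \<inter> affine hull c"
      using face_of_imp_eq_affine_Int [OF conv F(1)] by auto
    with c \<open>v \<in> c\<close> show "\<exists>c. v \<in> c \<and> c \<subseteq> V \<and> F = P \<inter> affine hull c"
      by blast
  qed
qed

text \<open>This makes the passage from vertex sets to faces injective and lets inclusions of faces
  be read off from vertex sets.\<close>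

lemma affine_independent_affine_hull_subset:
  assumes "\<not> affine_dependent V" "c \<subseteq> V" "d \<subseteq> V" "c \<subseteq> affine hull d"
  shows "c \<subseteq> d"
proof
  fix x assume "x \<in> c"
  show "x \<in> d"
  proof (rule ccontr)
    assume "x \<notin> d"
    then have "affine hull d \<subseteq> affine hull (V - {x})"
      using assms by (intro hull_mono) auto
    with assms \<open>x \<in> c\<close> show False
      unfolding affine_dependent_def by blast
  qed
qed

text \<open>Fix a vertex \<open>v\<close> of \<open>G\<close>; every face containing
  \<open>G\<close> contains \<open>v\<close>. With \<open>A\<close> the vertex set of
  \<open>G\<close> in the simplex at \<open>v\<close>, these faces correspond to the sets between
  \<open>A\<close> and \<open>V\<close>, where \<open>A\<close> has \<open>s + 1\<close> elements
  and \<open>V\<close> has \<open>n + 1\<close>.\<close>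

lemma card_faces_above:
  fixes P :: "'a::euclidean_space set"
  assumes P: "polytope P" and dimP: "aff_dim P = int n" and "j \<le> n"
    and simple: "\<And>v. v extreme_point_of P \<Longrightarrow>
      card {E. E face_of P \<and> aff_dim E = 1 \<and> v \<in> E} = n"
    and G: "G face_of P" "aff_dim G = int s"
  shows "card {F. F face_of P \<and> aff_dim F = int (n - j) \<and> G \<subseteq> F} = (n - s) choose j"
proof -
  have "G \<noteq> {}"
    using G by auto
  moreover have "polytope G"
    using G P face_of_polytope_polytope by blast
  ultimately obtain v where "v extreme_point_of G"
    using extreme_point_exists_convex polytope_imp_compact polytope_imp_convex by metis
  then have v: "v extreme_point_of P" "v \<in> G"
    using G extreme_point_of_face by blast+
  obtain V where V: "\<not> affine_dependent V" "v \<in> V" "V \<subseteq> P" "aff_dim V = aff_dim P"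
    and face: "\<And>c. v \<in> c \<Longrightarrow> c \<subseteq> V \<Longrightarrow> P \<inter> affine hull c face_of P"
    and ex: "\<And>F. F face_of P \<Longrightarrow> v \<in> F \<Longrightarrow> \<exists>c. v \<in> c \<and> c \<subseteq> V \<and> F = P \<inter> affine hull c"
    using simple_vertex_faces [OF P v(1)] simple [OF v(1)] dimP by auto
  obtain A where A: "v \<in> A" "A \<subseteq> V" "G = P \<inter> affine hull A"
    using ex G v by blast
  have fin: "finite V"
    using V aff_independent_finite by blast
  have cardV: "card V = n + 1"
    using aff_dim_affine_independent [OF V(1)] V(4) dimP by linarith
  \<comment> \<open>The section contains \<open>c\<close> and lies in \<open>affine hull c\<close>,
    so its dimension is that of the independent set \<open>c\<close>.\<close>
  have dim: "aff_dim (P \<inter> affine hull c) = int (card c) - 1" if "c \<subseteq> V" for c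
  proof -
    have "c \<subseteq> P \<inter> affine hull c"
      using that V(3) hull_subset [of c affine] by blast
    then have "aff_dim c \<le> aff_dim (P \<inter> affine hull c)"
      by (rule aff_dim_subset)
    moreover have "aff_dim (P \<inter> affine hull c) \<le> aff_dim (affine hull c)"
      by (intro aff_dim_subset) auto
    moreover have "\<not> affine_dependent c"
      using affine_independent_subset [OF V(1) that] .
    ultimately show ?thesis
      using aff_dim_affine_independent [of c] by simp
  qed
  have mono: "c \<subseteq> d" if "c \<subseteq> V" "d \<subseteq> V" "P \<inter> affine hull c \<subseteq> affine hull d" for c d
  proof (rule affine_independent_affine_hull_subset [OF V(1) that(1,2)])
    show "c \<subseteq> affine hull d"
      using that V(3) hull_subset [of c affine] by blast
  qed
  have cardA: "card A = s + 1"
    using dim [OF A(2)] A(3) G(2) by simp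
  \<comment> \<open>Faces are indexed by complements: removing \<open>j\<close> points of
    \<open>V - A\<close> from \<open>V\<close> leaves the \<open>n + 1 - j\<close> points of a face
    of dimension \<open>n - j\<close>.\<close>
  let ?D = "{d. d \<subseteq> V - A \<and> card d = j}"
  let ?f = "\<lambda>d. P \<inter> affine hull (V - d)"
  let ?R = "{F. F face_of P \<and> aff_dim F = int (n - j) \<and> G \<subseteq> F}"
  have "inj_on ?f ?D"
  proof (rule inj_onI)
    fix d e assume d: "d \<in> ?D" "e \<in> ?D" "?f d = ?f e"
    then have "V - d = V - e"
      using mono [of "V - d" "V - e"] mono [of "V - e" "V - d"] by blast
    with d show "d = e" by blast
  qed
  moreover have "?f ` ?D = ?R"
  proof
    show "?f ` ?D \<subseteq> ?R"
    proof
      fix F assume "F \<in> ?f ` ?D"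
      then obtain d where d: "d \<subseteq> V - A" "card d = j" "F = ?f d"
        by blast
      have "F face_of P"
        unfolding d(3) using A d V by (intro face) auto
      moreover have "card (V - d) = n + 1 - j"
        using d fin cardV by (subst card_Diff_subset) (auto intro: finite_subset)
      then have "aff_dim F = int (n - j)"
        unfolding d(3) using dim [of "V - d"] \<open>j \<le> n\<close> by auto
      moreover have "affine hull A \<subseteq> affine hull (V - d)"
        using A d by (intro hull_mono) auto
      then have "G \<subseteq> F"
        unfolding d(3) A(3) by blast
      ultimately show "F \<in> ?R" by blast
    qed
  next
    show "?R \<subseteq> ?f ` ?D"
    proof
      fix F assume F: "F \<in> ?R"
      then obtain c where c: "c \<subseteq> V" "F = P \<inter> affine hull c"
        using ex v by blast
      have "A \<subseteq> c"
        using F c(2) A(3) by (intro mono [OF A(2) c(1)]) auto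
      moreover have "int (card c) - 1 = int (n - j)"
        using dim [OF c(1)] F c by simp
      then have "card (V - c) = j"
        using c fin cardV \<open>j \<le> n\<close> by (subst card_Diff_subset) (auto intro: finite_subset)
      ultimately have "V - c \<in> ?D" by blast
      moreover have "F = ?f (V - c)"
        using c by (simp add: double_diff)
      ultimately show "F \<in> ?f ` ?D" by blast
    qed
  qed
  ultimately have "bij_betw ?f ?D ?R"
    by (rule bij_betw_imageI)
  then have "card ?R = card ?D"
    by (rule bij_betw_same_card [symmetric])
  also have "\<dots> = card (V - A) choose j"
    using fin by (intro n_subsets) auto
  also have "card (V - A) = n - s"
    using A fin cardV cardA by (subst card_Diff_subset) (auto intro: finite_subset)
  finally show ?thesis .
qed

section \<open>The binomial identity and the exchange of sums\<close>

text \<open>Both sides are the coefficient of x^p in (1+x)^(n-m) ((1+x) - x)^m = (1+x)^(n-m). The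
  proof is an induction on \<open>m\<close> by Pascal's rule.\<close>

lemma alternating_sum_choose_choose:
  assumes "m \<le> n"
  shows "(\<Sum>j=0..p. (-1::int) ^ j * int ((n - j) choose (p - j)) * int (m choose j))
    = int ((n - m) choose p)"
  using assms
proof (induction m arbitrary: n p)
  case 0
  have "(\<Sum>j=0..p. (-1::int) ^ j * int ((n - j) choose (p - j)) * int (0 choose j))
      = (\<Sum>j=0..p. if j = 0 then int (n choose p) else 0)"
    by (intro sum.cong) (auto simp: binomial_eq_0)
  then show ?case by simp
next
  case (Suc m)
  then obtain n' where n: "n = Suc n'" "m \<le> n'"
    by (cases n) auto
  show ?case
  proof (cases p)
    case 0
    then show ?thesis by simp
  next
    case (Suc q)
    let ?t = "\<lambda>n p m j. (-1::int) ^ j * int ((n - j) choose (p - j)) * int (m choose j)"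
    \<comment> \<open>Pascal's rule for \<open>Suc m choose Suc j\<close>; the second part is a term
      of the sum for \<open>n - 1\<close> and \<open>p - 1\<close>, with its sign flipped.\<close>
    have step: "?t n p (Suc m) (Suc j) = ?t n p m (Suc j) - ?t n' q m j" for j
      by (simp add: Suc n algebra_simps)
    have "(\<Sum>j=0..p. ?t n p (Suc m) j)
        = ?t n p m 0 + (\<Sum>j=0..q. ?t n p (Suc m) (Suc j))"
      unfolding Suc by (subst sum.atLeast0_atMost_Suc_shift) simp
    also have "\<dots> = ?t n p m 0 + (\<Sum>j=0..q. ?t n p m (Suc j) - ?t n' q m j)"
      by (simp only: step)
    also have "\<dots> = (\<Sum>j=0..p. ?t n p m j) - (\<Sum>j=0..q. ?t n' q m j)"
      by (simp add: Suc sum_subtractf sum.atLeast0_atMost_Suc_shift del: sum.cl_ivl_Suc)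
    also have "\<dots> = int ((n - m) choose p) - int ((n' - m) choose q)"
      using Suc.IH [of n p] Suc.IH [of n' q] n by simp
    also have "\<dots> = int ((n - Suc m) choose p)"
      using n by (simp add: Suc Suc_diff_le)
    finally show ?thesis .
  qed
qed

theorem theorem6p2:
  fixes \<Delta> :: "(real^'n) set" and n p :: nat
  assumes "lattice_polytope \<Delta>"
    and "simple_polytope \<Delta>"
    and "n = CARD('n)"
    and "aff_dim \<Delta> = int n"
    and "p \<le> n"
  shows "(\<Sum>j=0..p. (-1::int)^j * int ((n - j) choose (p - j)) *
            (\<Sum>F\<in>faces_of_dim (n - j) \<Delta>. int (lcount F)))
       = (\<Sum>s=p..n. int (s choose p) * (\<Sum>\<Gamma>\<in>faces_of_dim s \<Delta>. int (lcount_int \<Gamma>)))"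
proof -
  have P: "polytope \<Delta>"
    using assms(1) by (auto simp: lattice_polytope_def polytope_def)
  let ?A = "{G. G face_of \<Delta>}"
  let ?L = "\<lambda>s. \<Sum>G\<in>faces_of_dim s \<Delta>. int (lcount_int G)"
  have fin: "finite ?A"
    by (rule finite_polytope_faces [OF P])
  have finF: "finite (faces_of_dim k \<Delta>)" for k
    using fin by (rule rev_finite_subset) (auto simp: faces_of_dim_def)
  have simple: "card {E. E face_of \<Delta> \<and> aff_dim E = 1 \<and> v \<in> E} = n" if "v extreme_point_of \<Delta>" for v
    using assms(2,4) that by (simp add: simple_polytope_def faces_of_dim_def)
  \<comment> \<open>Double counting of pairs \<open>G \<subseteq> F\<close>: each \<open>G\<close>
    is weighted by the number of faces of dimension \<open>n - j\<close> above it.\<close>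
  have lcount_faces: "(\<Sum>F\<in>faces_of_dim (n - j) \<Delta>. int (lcount F))
      = (\<Sum>s=0..n. int ((n - s) choose j) * ?L s)" if "j \<le> n" for j
  proof -
    have "(\<Sum>F\<in>faces_of_dim (n - j) \<Delta>. int (lcount F))
        = (\<Sum>F\<in>faces_of_dim (n - j) \<Delta>. \<Sum>G | G \<in> ?A \<and> G \<subseteq> F. int (lcount_int G))"
    proof (rule sum.cong [OF refl])
      fix F assume "F \<in> faces_of_dim (n - j) \<Delta>"
      then have F: "F face_of \<Delta>"
        by (simp add: faces_of_dim_def)
      then have "{G. G face_of F} = {G. G \<in> ?A \<and> G \<subseteq> F}"
        by (auto simp: face_of_face)
      with lcount_eq_sum_lcount_int [OF face_of_polytope_polytope [OF P F]]
      show "int (lcount F) = (\<Sum>G | G \<in> ?A \<and> G \<subseteq> F. int (lcount_int G))"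
        by simp
    qed
    also have "\<dots> = (\<Sum>G\<in>?A. \<Sum>F | F \<in> faces_of_dim (n - j) \<Delta> \<and> G \<subseteq> F. int (lcount_int G))"
      by (rule sum.swap_restrict [OF finF fin])
    also have "\<dots> = (\<Sum>G\<in>?A. int (card {F. F \<in> faces_of_dim (n - j) \<Delta> \<and> G \<subseteq> F}) * int (lcount_int G))"
      by simp
    \<comment> \<open>Sorting by dimension drops only the empty face, whose relative interior has no
      lattice points.\<close>
    also have "\<dots> = (\<Sum>G\<in>(\<Union>s\<in>{0..n}. faces_of_dim s \<Delta>).
        int (card {F. F \<in> faces_of_dim (n - j) \<Delta> \<and> G \<subseteq> F}) * int (lcount_int G))"
    proof (rule sum.mono_neutral_right [OF fin])
      show "(\<Union>s\<in>{0..n}. faces_of_dim s \<Delta>) \<subseteq> ?A"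
        by (auto simp: faces_of_dim_def)
      show "\<forall>G\<in>?A - (\<Union>s\<in>{0..n}. faces_of_dim s \<Delta>).
        int (card {F. F \<in> faces_of_dim (n - j) \<Delta> \<and> G \<subseteq> F}) * int (lcount_int G) = 0"
      proof
        fix G assume G: "G \<in> ?A - (\<Union>s\<in>{0..n}. faces_of_dim s \<Delta>)"
        have "G = {}"
        proof (rule ccontr)
          assume "G \<noteq> {}"
          then have "0 \<le> aff_dim G"
            using aff_dim_geq [of G] aff_dim_empty [of G] by linarith
          moreover have "aff_dim G \<le> int n"
            using G assms(4) aff_dim_subset [of G \<Delta>] face_of_imp_subset by auto
          ultimately have "G \<in> faces_of_dim (nat (aff_dim G)) \<Delta>" "nat (aff_dim G) \<in> {0..n}"
            using G by (auto simp: faces_of_dim_def)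
          with G show False by blast
        qed
        then show "int (card {F. F \<in> faces_of_dim (n - j) \<Delta> \<and> G \<subseteq> F}) * int (lcount_int G) = 0"
          by (simp add: lcount_int_def)
      qed
    qed
    also have "\<dots> = (\<Sum>s=0..n. \<Sum>G\<in>faces_of_dim s \<Delta>.
        int (card {F. F \<in> faces_of_dim (n - j) \<Delta> \<and> G \<subseteq> F}) * int (lcount_int G))"
      by (rule sum.UNION_disjoint) (use finF in \<open>auto simp: faces_of_dim_def\<close>)
    also have "\<dots> = (\<Sum>s=0..n. \<Sum>G\<in>faces_of_dim s \<Delta>. int ((n - s) choose j) * int (lcount_int G))"
    proof (intro sum.cong refl)
      fix s G assume "G \<in> faces_of_dim s \<Delta>"
      then have "card {F. F face_of \<Delta> \<and> aff_dim F = int (n - j) \<and> G \<subseteq> F} = (n - s) choose j"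
        by (intro card_faces_above [OF P assms(4) that simple]) (auto simp: faces_of_dim_def)
      then show "int (card {F. F \<in> faces_of_dim (n - j) \<Delta> \<and> G \<subseteq> F}) * int (lcount_int G)
          = int ((n - s) choose j) * int (lcount_int G)"
        by (simp add: faces_of_dim_def)
    qed
    finally show ?thesis
      by (simp add: sum_distrib_left)
  qed
  have "(\<Sum>j=0..p. (-1::int)^j * int ((n - j) choose (p - j)) *
            (\<Sum>F\<in>faces_of_dim (n - j) \<Delta>. int (lcount F)))
      = (\<Sum>j=0..p. \<Sum>s=0..n. (-1::int)^j * int ((n - j) choose (p - j)) * int ((n - s) choose j) * ?L s)"
    using assms(5) by (intro sum.cong refl) (simp add: lcount_faces sum_distrib_left mult.assoc)
  also have "\<dots> = (\<Sum>s=0..n. (\<Sum>j=0..p. (-1::int)^j * int ((n - j) choose (p - j)) * int ((n - s) choose j)) * ?L s)"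
    by (subst sum.swap) (simp only: sum_distrib_right)
  \<comment> \<open>The identity is applied with \<open>m = n - s\<close>, so that
    \<open>n - m = s\<close>.\<close>
  also have "\<dots> = (\<Sum>s=0..n. int (s choose p) * ?L s)"
    by (intro sum.cong refl) (subst alternating_sum_choose_choose, auto)
  also have "\<dots> = (\<Sum>s=p..n. int (s choose p) * ?L s)"
    by (rule sum.mono_neutral_right) (auto simp: binomial_eq_0)
  finally show ?thesis .
qed

end
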